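(* For every $n>0$ and every integer composition $\alpha$ of $n$, there is an isomorphism of partially ordered sets $\mathcal{T}_{\alpha}\cong(\mathcal{C}_{\alpha},\leq_{\mathsf{comp}})$ between the $\alpha$-Tamari lattice $\mathcal{T}_\alpha=(\mathfrak{S}_\alpha(231),\leq_L)$ and the set $\mathcal{C}_\alpha$ ordered componentwise.
   Context: Let $n>0$, $[n]=\{1,\dots,n\}$, and let $\alpha=(\alpha_1,\dots,\alpha_r)$ be a composition of $n$ (positive integers summing to $n$). Put $s_0=0$ and $s_a=\alpha_1+\cdots+\alpha_a$ for $a\in[r]$. The $a$-th $\alpha$-region is $\{s_{a-1}+1,\dots,s_a\}$, and $\varrho(i)$ denotes the index $a$ of the region containing $i$, i.e. $s_{a-1}<i\le s_a$. $\mathfrak{S}_n$ is the symmetric group and $\mathfrak{S}_\alpha=\{w\in\mathfrak{S}_n\mid w(i)<w(i+1)\text{ whenever }\varrho(i)=\varrho(i+1)\}$; write $w_i=w(i)$. An element $w\in\mathfrak{S}_\alpha$ has an $(\alpha,231)$-pattern if there are indices $i<j<k$, each in a different $\alpha$-region, with $w_i<w_j$ and $w_i=w_k+1$. $\mathfrak{S}_\alpha(231)$ is the set of $w\in\mathfrak{S}_\alpha$ having no $(\alpha,231)$-pattern. $\mathrm{Inv}(w)=\{(i,j)\mid i<j,\ w_i>w_j\}$, and the (left) weak order is $u\leq_L v\iff \mathrm{Inv}(u)\subseteq\mathrm{Inv}(v)$. $\mathcal{T}_\alpha=(\mathfrak{S}_\alpha(231),\leq_L)$ is the $\alpha$-Tamari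 lattice (known to be a lattice). $\mathcal{C}_\alpha$ is the set of integer tuples $(c_1,\dots,c_n)$ such that: (C1) $0\le c_i\le n-s_{\varrho(i)}$ for all $i\in[n]$; (C2) $c_i\le c_{i+1}$ for all $i\in[n-1]$ with $\varrho(i)=\varrho(i+1)$; (C3) $c_{s_a}\le c_i-s_a+s_{\varrho(i)}$ for all $i\in[s_{r-2}]$ and all $a\in\{\varrho(i)+1,\dots,r-1\}$ such that $c_i\ge s_a-s_{\varrho(i)}$ (this condition is vacuous if $r\le 2$). For integer tuples of length $n$, $\mathbf a\leq_{\mathsf{comp}}\mathbf b$ means $a_i\le b_i$ for all $i\in[n]$. *)

theory Defs
  imports "HOL-Library.FuncSet" "HOL-Combinatorics.Permutations"
begin

definition composition_of :: "nat \<Rightarrow> nat list \<Rightarrow> bool" where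
  "composition_of n \<alpha> \<longleftrightarrow> (\<forall>a \<in> set \<alpha>. 0 < a) \<and> sum_list \<alpha> = n"

text \<open>The partial sum \<open>s\<^sub>a = \<alpha>\<^sub>1 + \<dots> + \<alpha>\<^sub>a\<close>, with \<open>s\<^sub>0 = 0\<close>.
  Regions and positions are numbered from 1.\<close>

definition psum :: "nat list \<Rightarrow> nat \<Rightarrow> nat" where
  "psum \<alpha> a = sum_list (take a \<alpha>)"

definition region :: "nat list \<Rightarrow> nat \<Rightarrow> nat" where
  "region \<alpha> i = (THE a. a \<in> {1..length \<alpha>} \<and> psum \<alpha> (a - 1) < i \<and> i \<le> psum \<alpha> a)"

definition alpha_perms :: "nat \<Rightarrow> nat list \<Rightarrow> (nat \<Rightarrow> nat) set" where
  "alpha_perms n \<alpha> =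
     {w. w permutes {1..n} \<and>
         (\<forall>i \<in> {1..n-1}. region \<alpha> i = region \<alpha> (i + 1) \<longrightarrow> w i < w (i + 1))}"

definition has_231_pattern :: "nat \<Rightarrow> nat list \<Rightarrow> (nat \<Rightarrow> nat) \<Rightarrow> bool" where
  "has_231_pattern n \<alpha> w \<longleftrightarrow>
     (\<exists>i \<in> {1..n}. \<exists>j \<in> {1..n}. \<exists>k \<in> {1..n}. i < j \<and> j < k \<and>
        region \<alpha> i \<noteq> region \<alpha> j \<and> region \<alpha> j \<noteq> region \<alpha> k \<and> region \<alpha> i \<noteq> region \<alpha> k \<and>
        w i < w j \<and> w i = w k + 1)"

definition alpha_perms_231 :: "nat \<Rightarrow> nat list \<Rightarrow> (nat \<Rightarrow> nat) set" where
  "alpha_perms_231 n \<alpha> = {w \<in> alpha_perms n \<alpha>. \<not> has_231_pattern n \<alpha> w}"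

definition Inv :: "nat \<Rightarrow> (nat \<Rightarrow> nat) \<Rightarrow> (nat \<times> nat) set" where
  "Inv n w = {(i, j). i \<in> {1..n} \<and> j \<in> {1..n} \<and> i < j \<and> w j < w i}"

definition left_weak_le :: "nat \<Rightarrow> (nat \<Rightarrow> nat) \<Rightarrow> (nat \<Rightarrow> nat) \<Rightarrow> bool" where
  "left_weak_le n u v \<longleftrightarrow> Inv n u \<subseteq> Inv n v"

text \<open>Integer tuples \<open>(c\<^sub>1, \<dots>, c\<^sub>n)\<close> are the extensional functions on \<open>{1..n}\<close>, so that
  distinct functions are distinct tuples.  In the third condition, \<open>length \<alpha> - 2\<close> is truncated
  subtraction; for fewer than three parts the range of \<open>i\<close> is empty.\<close>

definition C_tuples :: "nat \<Rightarrow> nat list \<Rightarrow> (nat \<Rightarrow> int) set" where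
  "C_tuples n \<alpha> =
     {c \<in> {1..n} \<rightarrow>\<^sub>E UNIV.
        (\<forall>i \<in> {1..n}. 0 \<le> c i \<and> c i \<le> int n - int (psum \<alpha> (region \<alpha> i))) \<and>
        (\<forall>i \<in> {1..n-1}. region \<alpha> i = region \<alpha> (i + 1) \<longrightarrow> c i \<le> c (i + 1)) \<and>
        (\<forall>i \<in> {1..psum \<alpha> (length \<alpha> - 2)}. \<forall>a \<in> {region \<alpha> i + 1..length \<alpha> - 1}.
           c i \<ge> int (psum \<alpha> a) - int (psum \<alpha> (region \<alpha> i)) \<longrightarrow>
           c (psum \<alpha> a) \<le> c i - int (psum \<alpha> a) + int (psum \<alpha> (region \<alpha> i)))}"

definition comp_le :: "nat \<Rightarrow> (nat \<Rightarrow> int) \<Rightarrow> (nat \<Rightarrow> int) \<Rightarrow> bool" where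
  "comp_le n a b \<longleftrightarrow> (\<forall>i \<in> {1..n}. a i \<le> b i)"

text \<open>The library's \<^const>\<open>iso\<close> preserves initial segments and is intended for
  well-orders only, hence the following notion for arbitrary posets.\<close>

definition poset_iso :: "'a set \<Rightarrow> 'a rel \<Rightarrow> 'b set \<Rightarrow> 'b rel \<Rightarrow> ('a \<Rightarrow> 'b) \<Rightarrow> bool" where
  "poset_iso A r B r' f \<longleftrightarrow>
     partial_order_on A r \<and> partial_order_on B r' \<and> bij_betw f A B \<and>
     (\<forall>x \<in> A. \<forall>y \<in> A. (x, y) \<in> r \<longleftrightarrow> (f x, f y) \<in> r')"

end

theory Submission
  imports Defs
begin

text \<open>Write \<open>e\<close> for the last position of the region of \<open>i\<close>, and send \<open>w\<close> to the tuple whose \<open>i\<close>-th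
  entry is the largest \<open>t\<close> such that \<open>w\<close> is below \<open>w i\<close> on all of \<open>{e + 1..e + t}\<close>. (This is not the
  Lehmer code: \<open>3|24|1\<close> is sent to \<open>(1,1,1,0)\<close>, although 1 is the left end of two inversions.) Conversely
  a tuple \<open>c\<close> determines the relation of all pairs \<open>(i, k)\<close> with \<open>e < k \<le> e + c i\<close>. If \<open>w\<close> has no
  pattern and \<open>(i, k)\<close> is an inversion outside this relation, then there is \<open>w j > w i\<close> with \<open>j\<close> in a
  region strictly between those of \<open>i\<close> and \<open>k\<close>, and going through the values from \<open>w k\<close> to \<open>w i\<close> one must meet the
  region of \<open>j\<close>, which splits the inversion in two. Hence the inversion set is the transitive
  closure of the relation, so the map is an order embedding. Conversely, for \<open>c\<close> in \<open>C_tuples\<close> (C2) makes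
  the complement of the transitive closure transitive as well, so that it is an inversion set, and
  (C3) says that the closure does not prolong the initial runs, so that \<open>c\<close> is recovered.\<close>

section \<open>Permutations and their inversion sets\<close>

lemma Inv_iff: "(i, j) \<in> Inv n w \<longleftrightarrow> 1 \<le> i \<and> i < j \<and> j \<le> n \<and> w j < w i"
  by (auto simp: Inv_def)

lemma trans_Inv: "trans (Inv n w)"
  by (rule transI) (auto simp: Inv_iff)

text \<open>The counted positions are mapped by \<open>w\<close> bijectively onto
  \<open>{1..w i}\<close>. A value is thus a rank, determined by comparisons alone.\<close>

lemma permutes_eq_card:
  assumes "w permutes {1..n}" "i \<in> {1..n}"
  shows "w i = card {k \<in> {1..n}. w k \<le> w i}"
proof -
  have "bij_betw w {k \<in> {1..n}. w k \<le> w i} {1..w i}"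
  proof (rule bij_betw_imageI)
    show "inj_on w {k \<in> {1..n}. w k \<le> w i}"
      using permutes_inj[OF assms(1)] by (rule inj_on_subset) auto
    show "w ` {k \<in> {1..n}. w k \<le> w i} = {1..w i}"
    proof
      show "w ` {k \<in> {1..n}. w k \<le> w i} \<subseteq> {1..w i}"
        using permutes_in_image[OF assms(1)] by fastforce
      show "{1..w i} \<subseteq> w ` {k \<in> {1..n}. w k \<le> w i}"
      proof
        fix v assume v: "v \<in> {1..w i}"
        moreover have "w i \<in> {1..n}"
          using permutes_in_image[OF assms(1)] assms(2) by blast
        ultimately have "v \<in> w ` {1..n}"
          using permutes_image[OF assms(1)] by auto
        then show "v \<in> w ` {k \<in> {1..n}. w k \<le> w i}"
          using v by auto
      qed
    qed
  qed
  then show ?thesis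
    by (simp add: bij_betw_same_card)
qed

text \<open>For two distinct positions the inversion set decides which carries the larger value, so
  \<open>u\<close> and \<open>v\<close> have the same ranks.\<close>

lemma Inv_inject:
  assumes u: "u permutes {1..n}" and v: "v permutes {1..n}" and eq: "Inv n u = Inv n v"
  shows "u = v"
proof
  fix i
  show "u i = v i"
  proof (cases "i \<in> {1..n}")
    case True
    have "u k \<le> u i \<longleftrightarrow> v k \<le> v i" if k: "k \<in> {1..n}" for k
    proof (cases k i rule: linorder_cases)
      case less
      have "(k, i) \<in> Inv n u \<longleftrightarrow> (k, i) \<in> Inv n v"
        by (simp only: eq)
      then have "u i < u k \<longleftrightarrow> v i < v k"
        using less k True by (simp add: Inv_iff)
      then show ?thesis
        by (simp add: not_less[symmetric])
    next
      case greater
      then have "u k \<noteq> u i" "v k \<noteq> v i"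
        by (simp_all add: inj_eq[OF permutes_inj[OF u]] inj_eq[OF permutes_inj[OF v]])
      have "(i, k) \<in> Inv n u \<longleftrightarrow> (i, k) \<in> Inv n v"
        by (simp only: eq)
      then have "u k < u i \<longleftrightarrow> v k < v i"
        using greater k True by (simp add: Inv_iff)
      then show ?thesis
        using \<open>u k \<noteq> u i\<close> \<open>v k \<noteq> v i\<close> by (simp add: le_less)
    qed simp
    then have "card {k \<in> {1..n}. u k \<le> u i} = card {k \<in> {1..n}. v k \<le> v i}"
      by (intro arg_cong[where f = card]) blast
    with permutes_eq_card[OF u True, symmetric] permutes_eq_card[OF v True, symmetric]
    show ?thesis
      by (rule box_equals[rotated])
  next
    case False
    then show ?thesis
      using u v by (simp add: permutes_not_in)
  qed
qed

text \<open>The classical description of inversion sets as biclosed sets: reversing exactly the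
  pairs of \<open>T\<close> in the natural order of positions gives a linear order, and
  \<open>w\<close> ranks the positions by it.\<close>

lemma biclosed_eq_Inv:
  fixes T :: "(nat \<times> nat) set"
  assumes T: "\<And>i j. (i, j) \<in> T \<Longrightarrow> 1 \<le> i \<and> i < j \<and> j \<le> n"
    and "trans T"
    and cotrans: "\<And>i j k. (i, k) \<in> T \<Longrightarrow> i < j \<Longrightarrow> j < k \<Longrightarrow> (i, j) \<in> T \<or> (j, k) \<in> T"
  obtains w where "w permutes {1..n}" "Inv n w = T"
proof -
  \<comment> \<open>\<open>L a b\<close> is to mean that \<open>a\<close> receives a smaller value
    than \<open>b\<close>. Its transitivity needs both closure properties of \<open>T\<close>,
    depending on the relative order of the three positions.\<close>
  define L where "L a b \<longleftrightarrow> a < b \<and> (a, b) \<notin> T \<or> b < a \<and> (b, a) \<in> T" for a b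
  have trans: "(i, k) \<in> T" if "(i, j) \<in> T" "(j, k) \<in> T" for i j k
    using \<open>trans T\<close> that by (rule transD)
  have L_total: "L a b \<or> L b a" if "a \<noteq> b" for a b
    using that by (auto simp: L_def)
  have L_asym: "\<not> L b a" if "L a b" for a b
    using that by (auto simp: L_def)
  have L_trans: "L a c" if ab: "L a b" and bc: "L b c" for a b c
  proof -
    have "a \<noteq> c"
      using L_asym ab bc by blast
    moreover have "a \<noteq> b" "b \<noteq> c"
      using ab bc by (auto simp: L_def)
    ultimately consider "a < b" "b < c" | "b < a" "a < c" | "a < c" "c < b"
      | "c < b" "b < a" | "b < c" "c < a" | "c < a" "a < b"
      by linarith
    then show ?thesis
    proof cases
      case 1
      then show ?thesis
        using ab bc cotrans[of a c b] by (auto simp: L_def)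
    next
      case 2
      then show ?thesis
        using ab bc trans[of b a c] by (auto simp: L_def)
    next
      case 3
      then show ?thesis
        using ab bc trans[of a c b] by (auto simp: L_def)
    next
      case 4
      then show ?thesis
        using ab bc trans[of c b a] by (auto simp: L_def)
    next
      case 5
      then show ?thesis
        using ab bc cotrans[of b a c] by (auto simp: L_def)
    next
      case 6
      then show ?thesis
        using ab bc cotrans[of c b a] by (auto simp: L_def)
    qed
  qed
  \<comment> \<open>Counting \<open>i\<close> itself makes ranks start at 1; the identity outside
    \<open>{1..n}\<close> is what \<open>permutes\<close> demands.\<close>
  define w where "w i = (if i \<in> {1..n} then card {k \<in> {1..n}. k = i \<or> L k i} else i)" for i
  have w_less: "w a < w b" if "a \<in> {1..n}" "b \<in> {1..n}" "L a b" for a b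
  proof -
    have sub: "{k \<in> {1..n}. k = a \<or> L k a} \<subset> {k \<in> {1..n}. k = b \<or> L k b}"
    proof (rule psubsetI)
      show "{k \<in> {1..n}. k = a \<or> L k a} \<subseteq> {k \<in> {1..n}. k = b \<or> L k b}"
        using L_trans \<open>L a b\<close> by blast
      have "b \<notin> {k \<in> {1..n}. k = a \<or> L k a}"
        using L_asym \<open>L a b\<close> by blast
      then show "{k \<in> {1..n}. k = a \<or> L k a} \<noteq> {k \<in> {1..n}. k = b \<or> L k b}"
        using \<open>b \<in> {1..n}\<close> by blast
    qed
    then show ?thesis
      using psubset_card_mono[OF _ sub] that(1,2) unfolding w_def by simp
  qed
  have "w permutes {1..n}"
  proof (rule bij_imp_permutes)
    have inj: "inj_on w {1..n}"
    proof (rule inj_onI, rule ccontr)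
      fix a b assume ab: "a \<in> {1..n}" "b \<in> {1..n}" "w a = w b" "a \<noteq> b"
      then show False
        using L_total[of a b] w_less[of a b] w_less[of b a] by auto
    qed
    have "w i \<in> {1..n}" if "i \<in> {1..n}" for i
    proof -
      have "card {k \<in> {1..n}. k = i \<or> L k i} \<le> card {1..n}"
        by (rule card_mono) auto
      moreover have "0 < card {k \<in> {1..n}. k = i \<or> L k i}"
        using that by (auto simp: card_gt_0_iff)
      ultimately show ?thesis
        using that by (simp add: w_def)
    qed
    then have "w ` {1..n} = {1..n}"
      using inj by (intro endo_inj_surj) auto
    then show "bij_betw w {1..n} {1..n}"
      using inj by (simp add: bij_betw_def)
  qed (auto simp: w_def)
  moreover have "Inv n w = T"
  proof (rule set_eqI, clarify)
    fix i j
    show "(i, j) \<in> Inv n w \<longleftrightarrow> (i, j) \<in> T"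
    proof (cases "1 \<le> i \<and> i < j \<and> j \<le> n")
      case True
      then show ?thesis
        using w_less[of i j] w_less[of j i] by (cases "(i, j) \<in> T") (auto simp: Inv_iff L_def)
    next
      case False
      then show ?thesis
        using T[of i j] Inv_iff[of i j n w] by meson
    qed
  qed
  ultimately show ?thesis
    by (rule that)
qed

section \<open>Regions\<close>

locale composition =
  fixes n :: nat and \<alpha> :: "nat list"
  assumes comp: "composition_of n \<alpha>"
begin

lemma psum_0 [simp]: "psum \<alpha> 0 = 0"
  by (simp add: psum_def)

lemma psum_length [simp]: "psum \<alpha> (length \<alpha>) = n"
  using comp by (simp add: psum_def composition_of_def)

lemma psum_mono: "a \<le> b \<Longrightarrow> psum \<alpha> a \<le> psum \<alpha> b"
  by (metis le_add1 le_add_diff_inverse psum_def sum_list_append take_add)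

lemma psum_Suc_less: "a < length \<alpha> \<Longrightarrow> psum \<alpha> a < psum \<alpha> (Suc a)"
  using comp by (simp add: psum_def composition_of_def take_Suc_conv_app_nth)

lemma psum_strict_mono: "a < b \<Longrightarrow> b \<le> length \<alpha> \<Longrightarrow> psum \<alpha> a < psum \<alpha> b"
  using psum_Suc_less[of a] psum_mono[of "Suc a" b] by simp

lemma region_eqI:
  assumes "a \<in> {1..length \<alpha>}" "psum \<alpha> (a - 1) < i" "i \<le> psum \<alpha> a"
  shows "region \<alpha> i = a"
  unfolding region_def
proof (rule the_equality)
  fix b assume b: "b \<in> {1..length \<alpha>} \<and> psum \<alpha> (b - 1) < i \<and> i \<le> psum \<alpha> b"
  show "b = a"
  proof (cases a b rule: linorder_cases)
    case less
    then show ?thesis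
      using psum_mono[of a "b - 1"] b assms by linarith
  next
    case greater
    then show ?thesis
      using psum_mono[of b "a - 1"] b assms by linarith
  qed simp
qed (use assms in blast)

lemma region_bounds:
  assumes "1 \<le> i" "i \<le> n"
  shows "region \<alpha> i \<in> {1..length \<alpha>}" "psum \<alpha> (region \<alpha> i - 1) < i" "i \<le> psum \<alpha> (region \<alpha> i)"
proof -
  \<comment> \<open>A witness for the definite description in \<open>region\<close>: minimality of
    this index gives the strict lower bound, and \<open>psum \<alpha> 0 = 0\<close> keeps it
    positive.\<close>
  define a where "a = (LEAST a. i \<le> psum \<alpha> a)"
  have i: "i \<le> psum \<alpha> (length \<alpha>)"
    using assms by simp
  have a: "i \<le> psum \<alpha> a" "a \<le> length \<alpha>"
    unfolding a_def using i by (rule LeastI, rule Least_le)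
  have "a \<noteq> 0"
    using a(1) assms by (metis psum_0 not_one_le_zero le_zero_eq)
  moreover from this have "psum \<alpha> (a - 1) < i"
    using not_less_Least[of "a - 1" "\<lambda>a. i \<le> psum \<alpha> a"] by (simp add: a_def[symmetric])
  ultimately have "region \<alpha> i = a" "a \<in> {1..length \<alpha>}" "psum \<alpha> (a - 1) < i"
    using a region_eqI[of a i] by auto
  then show "region \<alpha> i \<in> {1..length \<alpha>}" "psum \<alpha> (region \<alpha> i - 1) < i" "i \<le> psum \<alpha> (region \<alpha> i)"
    using a by auto
qed

text \<open>The position \<open>e\<close> of the introduction. It turns comparisons of regions into
  comparisons of positions.\<close>

definition rend :: "nat \<Rightarrow> nat" where
  "rend i = psum \<alpha> (region \<alpha> i)"

lemma rend_ge: "1 \<le> i \<Longrightarrow> i \<le> n \<Longrightarrow> i \<le> rend i"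
  using region_bounds by (simp add: rend_def)

lemma rend_le: "1 \<le> i \<Longrightarrow> i \<le> n \<Longrightarrow> rend i \<le> n"
  using region_bounds(1)[of i] psum_mono[of "region \<alpha> i" "length \<alpha>"] by (simp add: rend_def)

lemma region_psum: "a \<in> {1..length \<alpha>} \<Longrightarrow> region \<alpha> (psum \<alpha> a) = a"
  by (rule region_eqI) (auto intro: psum_strict_mono)

lemma region_mono:
  assumes "1 \<le> i" "i \<le> j" "j \<le> n"
  shows "region \<alpha> i \<le> region \<alpha> j"
proof (rule ccontr)
  assume "\<not> ?thesis"
  then have "psum \<alpha> (region \<alpha> j) \<le> psum \<alpha> (region \<alpha> i - 1)"
    by (intro psum_mono) linarith
  then show False
    using region_bounds(2)[of i] region_bounds(3)[of j] assms by linarith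
qed

lemma region_less_iff:
  assumes "1 \<le> i" "i \<le> n" "1 \<le> j" "j \<le> n"
  shows "region \<alpha> i < region \<alpha> j \<longleftrightarrow> rend i < j"
proof
  assume "region \<alpha> i < region \<alpha> j"
  then have "rend i \<le> psum \<alpha> (region \<alpha> j - 1)"
    unfolding rend_def by (intro psum_mono) linarith
  then show "rend i < j"
    using region_bounds(2)[of j] assms by linarith
next
  assume *: "rend i < j"
  show "region \<alpha> i < region \<alpha> j"
  proof (rule ccontr)
    assume "\<not> ?thesis"
    then have "rend j \<le> rend i"
      using psum_mono by (simp add: rend_def)
    then show False
      using * rend_ge[of j] assms by simp
  qed
qed

lemma region_eq_iff:
  assumes "1 \<le> i" "i \<le> j" "j \<le> n"
  shows "region \<alpha> i = region \<alpha> j \<longleftrightarrow> j \<le> rend i"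
  using region_less_iff[of i j] region_mono[of i j] assms by auto

text \<open>Stated for a general preorder because it serves both the natural values of a permutation
  and the integer entries of a tuple.\<close>

lemma increasing_on_regions:
  fixes f :: "nat \<Rightarrow> 'b::preorder"
  assumes step: "\<And>i. i \<in> {1..n-1} \<Longrightarrow> region \<alpha> i = region \<alpha> (i + 1) \<Longrightarrow> f i \<le> f (i + 1)"
    and i: "1 \<le> i" "i \<le> j" "j \<le> n" "j \<le> rend i"
  shows "f i \<le> f j"
  using i(2) i(3,4)
proof (induction j rule: dec_induct)
  case (step k)
  have "region \<alpha> i = region \<alpha> k" "region \<alpha> i = region \<alpha> (Suc k)"
    using region_eq_iff[of i k] region_eq_iff[of i "Suc k"] step i by auto
  then have "f k \<le> f (Suc k)"
    using assms(1)[of k] step i by simp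
  then show ?case
    using step order_trans[of "f i" "f k"] by simp
qed simp

lemma alpha_permsD:
  assumes "w \<in> alpha_perms n \<alpha>"
  shows "w permutes {1..n}"
    and "1 \<le> i \<Longrightarrow> i \<le> j \<Longrightarrow> j \<le> n \<Longrightarrow> j \<le> rend i \<Longrightarrow> w i \<le> w j"
proof -
  show "w permutes {1..n}"
    using assms by (simp add: alpha_perms_def)
  show "w i \<le> w j" if "1 \<le> i" "i \<le> j" "j \<le> n" "j \<le> rend i"
    using assms that by (intro increasing_on_regions[of w i j]) (auto simp: alpha_perms_def intro: less_imp_le)
qed

lemma Inv_rend_less:
  assumes "w \<in> alpha_perms n \<alpha>" "(i, j) \<in> Inv n w"
  shows "rend i < j"
  using alpha_permsD(2)[OF assms(1), of i j] assms(2) by (force simp: Inv_iff)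

text \<open>The last clause is (C3) in terms of end points: if the run of \<open>i\<close> covers
  the region of \<open>j\<close>, it also covers the run that starts after that region and belongs
  to its last position.\<close>

lemma C_tuplesD:
  assumes "c \<in> C_tuples n \<alpha>"
  shows "c \<in> extensional {1..n}"
    and "1 \<le> i \<Longrightarrow> i \<le> n \<Longrightarrow> 0 \<le> c i"
    and "1 \<le> i \<Longrightarrow> i \<le> n \<Longrightarrow> int (rend i) + c i \<le> int n"
    and "1 \<le> i \<Longrightarrow> i \<le> j \<Longrightarrow> j \<le> n \<Longrightarrow> j \<le> rend i \<Longrightarrow> c i \<le> c j"
    and "1 \<le> i \<Longrightarrow> i \<le> n \<Longrightarrow> rend i < j \<Longrightarrow> rend j < n \<Longrightarrow> j \<le> n \<Longrightarrow> int (rend j) \<le> int (rend i) + c i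
      \<Longrightarrow> int (rend j) + c (rend j) \<le> int (rend i) + c i"
proof -
  have c2: "\<And>i. i \<in> {1..n-1} \<Longrightarrow> region \<alpha> i = region \<alpha> (i + 1) \<Longrightarrow> c i \<le> c (i + 1)"
    and c3: "\<And>i a. i \<in> {1..psum \<alpha> (length \<alpha> - 2)} \<Longrightarrow> a \<in> {region \<alpha> i + 1..length \<alpha> - 1} \<Longrightarrow>
           c i \<ge> int (psum \<alpha> a) - int (psum \<alpha> (region \<alpha> i)) \<Longrightarrow>
           c (psum \<alpha> a) \<le> c i - int (psum \<alpha> a) + int (psum \<alpha> (region \<alpha> i))"
    using assms by (auto simp: C_tuples_def)
  show "c \<in> extensional {1..n}"
    using assms by (simp add: C_tuples_def PiE_def)
  have "0 \<le> c i \<and> c i \<le> int n - int (rend i)" if "1 \<le> i" "i \<le> n"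
    using assms that by (simp add: C_tuples_def rend_def)
  then show "1 \<le> i \<Longrightarrow> i \<le> n \<Longrightarrow> 0 \<le> c i"
    "1 \<le> i \<Longrightarrow> i \<le> n \<Longrightarrow> int (rend i) + c i \<le> int n"
    by linarith+
  show "c i \<le> c j" if "1 \<le> i" "i \<le> j" "j \<le> n" "j \<le> rend i"
    using increasing_on_regions[of c] c2 that by blast
  show "int (rend j) + c (rend j) \<le> int (rend i) + c i"
    if *: "1 \<le> i" "i \<le> n" "rend i < j" "rend j < n" "j \<le> n" "int (rend j) \<le> int (rend i) + c i"
  proof -
    have "1 \<le> j"
      using * by simp
    then have reg: "region \<alpha> i < region \<alpha> j" "region \<alpha> j \<in> {1..length \<alpha>}"
      using region_less_iff[of i j] region_bounds(1)[of j] * by auto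
    have "region \<alpha> j \<noteq> length \<alpha>"
      using *(4) psum_length by (metis rend_def less_irrefl)
    then have reg': "region \<alpha> j \<in> {region \<alpha> i + 1..length \<alpha> - 1}"
      using reg by auto
    \<comment> \<open>The region of \<open>j\<close> lies after that of \<open>i\<close> and is not
      the last one, so the region of \<open>i\<close> has index at most
      \<open>length \<alpha> - 2\<close>.\<close>
    have "rend i \<le> psum \<alpha> (length \<alpha> - 2)"
      unfolding rend_def using reg' by (intro psum_mono) auto
    then have "i \<in> {1..psum \<alpha> (length \<alpha> - 2)}"
      using rend_ge[of i] *(1,2) by simp
    from c3[OF this reg'] show ?thesis
      using *(6) by (simp add: rend_def)
  qed
qed

section \<open>The tuple of a permutation\<close>

text \<open>The absolute end \<open>e + t\<close> of the initial run. An empty run gives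
  \<open>rend i\<close>, which always qualifies, so the maximum is over a nonempty set for positions
  in range.\<close>

definition reach :: "(nat \<Rightarrow> nat) \<Rightarrow> nat \<Rightarrow> nat" where
  "reach w i = Max {m \<in> {rend i..n}. \<forall>j \<in> {rend i<..m}. w j < w i}"

definition code :: "(nat \<Rightarrow> nat) \<Rightarrow> nat \<Rightarrow> int" where
  "code w = (\<lambda>i \<in> {1..n}. int (reach w i) - int (rend i))"

text \<open>The bounds on \<open>i\<close> and \<open>k\<close> belong to the relation, so it makes
  sense for every integer function and not only for elements of \<open>C_tuples\<close>.\<close>

definition short :: "(nat \<Rightarrow> int) \<Rightarrow> (nat \<times> nat) set" where
  "short c = {(i, k). 1 \<le> i \<and> i \<le> n \<and> rend i < k \<and> k \<le> n \<and> int k \<le> int (rend i) + c i}"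

lemma reach_mem:
  assumes "1 \<le> i" "i \<le> n"
  shows "reach w i \<in> {m \<in> {rend i..n}. \<forall>j \<in> {rend i<..m}. w j < w i}" (is "_ \<in> ?S")
proof -
  have "rend i \<in> ?S"
    using rend_le assms by simp
  then have "?S \<noteq> {}"
    by blast
  then show ?thesis
    unfolding reach_def by (intro Max_in) simp_all
qed

lemma reach_bounds:
  assumes "1 \<le> i" "i \<le> n"
  shows "rend i \<le> reach w i" "reach w i \<le> n"
  using reach_mem[OF assms, of w] by simp_all

lemma le_reach_iff:
  assumes "1 \<le> i" "i \<le> n" "rend i \<le> k" "k \<le> n"
  shows "k \<le> reach w i \<longleftrightarrow> (\<forall>j \<in> {rend i<..k}. w j < w i)"
proof
  assume "k \<le> reach w i"
  then show "\<forall>j \<in> {rend i<..k}. w j < w i"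
    using reach_mem[of i w] assms(1,2) by simp
next
  assume "\<forall>j \<in> {rend i<..k}. w j < w i"
  then show "k \<le> reach w i"
    unfolding reach_def using assms(3,4) by (intro Max_ge) simp_all
qed

lemma short_code_iff:
  "(i, k) \<in> short (code w) \<longleftrightarrow>
    1 \<le> i \<and> i \<le> n \<and> rend i < k \<and> k \<le> n \<and> (\<forall>j \<in> {rend i<..k}. w j < w i)"
proof (cases "1 \<le> i \<and> i \<le> n \<and> rend i < k \<and> k \<le> n")
  case True
  then have "(i, k) \<in> short (code w) \<longleftrightarrow> k \<le> reach w i"
    by (simp add: short_def code_def)
  then show ?thesis
    using True by (simp add: le_reach_iff)
qed (auto simp: short_def)

lemma short_mono:
  assumes "comp_le n c d"
  shows "short c \<subseteq> short d"
proof clarify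
  fix i k assume ik: "(i, k) \<in> short c"
  then have "c i \<le> d i"
    using assms by (simp add: short_def comp_le_def)
  then show "(i, k) \<in> short d"
    using ik by (simp add: short_def)
qed

text \<open>The run of \<open>i\<close> under \<open>u\<close> consists of inversions of
  \<open>u\<close>, hence of \<open>v\<close>, so the run under \<open>v\<close> is at least as
  long.\<close>

lemma code_mono:
  assumes "Inv n u \<subseteq> Inv n v"
  shows "comp_le n (code u) (code v)"
  unfolding comp_le_def
proof
  fix i assume i: "i \<in> {1..n}"
  have "v j < v i" if "j \<in> {rend i<..reach u i}" for j
  proof -
    have "u j < u i"
      using le_reach_iff[of i "reach u i" u] reach_bounds[of i u] i that by auto
    then have "(i, j) \<in> Inv n u"
      using i that reach_bounds[of i u] rend_ge[of i] by (simp add: Inv_iff)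
    then have "(i, j) \<in> Inv n v"
      using assms by blast
    then show ?thesis
      by (simp add: Inv_iff)
  qed
  then show "code u i \<le> code v i"
    using le_reach_iff[of i "reach u i" v] reach_bounds[of i u] i by (simp add: code_def)
qed

lemma Inv_eq_trancl_short:
  assumes w: "w \<in> alpha_perms_231 n \<alpha>"
  shows "Inv n w = (short (code w))\<^sup>+"
proof
  have wa: "w \<in> alpha_perms n \<alpha>" and no_pat: "\<not> has_231_pattern n \<alpha> w"
    using w by (auto simp: alpha_perms_231_def)
  have perm: "w permutes {1..n}"
    using wa by (rule alpha_permsD)
  have "short (code w) \<subseteq> Inv n w"
    using rend_ge by (fastforce simp: short_code_iff Inv_iff)
  then show "(short (code w))\<^sup>+ \<subseteq> Inv n w"
    by (metis trancl_id trancl_mono_subset trans_Inv)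
  have "(i, k) \<in> Inv n w \<Longrightarrow> (i, k) \<in> (short (code w))\<^sup>+" for i k
  \<comment> \<open>Splitting at an intermediate value makes both halves smaller in this
    measure.\<close>
  proof (induction "w i - w k" arbitrary: i k rule: less_induct)
    case less
    have ik: "1 \<le> i" "i < k" "k \<le> n" "w k < w i"
      using less.prems by (auto simp: Inv_iff)
    have rk: "rend i < k"
      using Inv_rend_less[OF wa less.prems] .
    show ?case
    proof (cases "(i, k) \<in> short (code w)")
      case False
      then obtain j where j: "rend i < j" "j \<le> k" "w i \<le> w j"
        using ik rk by (auto simp: short_code_iff not_less)
      have jn: "1 \<le> j" "j \<le> n"
        using j ik by auto
      have ij: "i < j"
        using j(1) rend_ge[of i] ik by simp
      \<comment> \<open>Values increase within a region and \<open>w k < w i \<le> w j\<close>, so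
        \<open>j\<close> cannot share the region of \<open>k\<close>.\<close>
      have jk: "rend j < k"
        using alpha_permsD(2)[OF wa, of j k] jn j ik by force
      have wij: "w i < w j"
        using j(3) ij inj_eq[OF permutes_inj[OF perm], of i j] by simp
      have reg: "region \<alpha> i < region \<alpha> j" "region \<alpha> j < region \<alpha> k"
        using region_less_iff[of i j] region_less_iff[of j k] j jk ik jn by auto
      have "\<exists>m. 1 \<le> m \<and> m \<le> n \<and> region \<alpha> m = region \<alpha> j \<and> w k < w m \<and> w m < w i"
      proof (rule ccontr)
        assume none: "\<not> ?thesis"
        \<comment> \<open>Climbing one value at a time from \<open>w k\<close>, all positions met
          stay right of the region of \<open>j\<close>: entering that region is excluded by
          \<open>none\<close>, and jumping over it to some \<open>m\<close> would make
          \<open>m\<close>, \<open>j\<close>, \<open>l\<close> a pattern, since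
          \<open>w m = w l + 1\<close> and \<open>w m \<le> w i < w j\<close>. At the value
          \<open>w i\<close> this contradicts the place of \<open>i\<close>.\<close>
        have "\<exists>l. 1 \<le> l \<and> l \<le> n \<and> w l = v \<and> region \<alpha> j < region \<alpha> l"
          if "w k \<le> v" "v \<le> w i" for v
          using that
        proof (induction v rule: dec_induct)
          case base
          then show ?case
            using reg ik by (intro exI[of _ k]) auto
        next
          case (step v)
          then obtain l where l: "1 \<le> l" "l \<le> n" "w l = v" "region \<alpha> j < region \<alpha> l"
            by auto
          have "w i \<le> n"
            using permutes_in_image[OF perm, of i] ik by auto
          then have "Suc v \<in> w ` {1..n}"
            using permutes_image[OF perm] step by auto
          then obtain m where m: "1 \<le> m" "m \<le> n" "w m = Suc v"
            by auto
          have "region \<alpha> m \<noteq> region \<alpha> j"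
          proof
            assume eq: "region \<alpha> m = region \<alpha> j"
            then have "m \<noteq> i"
              using reg by auto
            then have "w m \<noteq> w i"
              by (simp add: inj_eq[OF permutes_inj[OF perm]])
            then have "w k < w m" "w m < w i"
              using m step by linarith+
            then show False
              using none eq m by blast
          qed
          moreover have "\<not> region \<alpha> m < region \<alpha> j"
          proof
            assume lt: "region \<alpha> m < region \<alpha> j"
            have "m < j" "j < l"
              using region_mono[of j m] region_mono[of l j] lt l m jn by force+
            then have "has_231_pattern n \<alpha> w"
              unfolding has_231_pattern_def using lt l m jn step wij
              by (intro bexI[of _ m] bexI[of _ j] bexI[of _ l]) auto
            then show False
              using no_pat by simp
          qed
          ultimately show ?case
            using m by (intro exI[of _ m]) auto
        qed
        from this[of "w i"] obtain l where "w l = w i" "region \<alpha> j < region \<alpha> l"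
          using ik by auto
        then show False
          using reg by (simp add: inj_eq[OF permutes_inj[OF perm]])
      qed
      then obtain m where m: "1 \<le> m" "m \<le> n" "region \<alpha> m = region \<alpha> j" "w k < w m" "w m < w i"
        by auto
      have "i < m" "m < k"
        using region_mono[of m i] region_mono[of k m] m reg ik by force+
      then have "(i, m) \<in> Inv n w" "(m, k) \<in> Inv n w"
        using m ik by (auto simp: Inv_iff)
      then have "(i, m) \<in> (short (code w))\<^sup>+" "(m, k) \<in> (short (code w))\<^sup>+"
        using less.hyps[of i m] less.hyps[of m k] m by auto
      then show ?thesis
        by (rule trancl_trans)
    qed auto
  qed
  then show "Inv n w \<subseteq> (short (code w))\<^sup>+"
    by auto
qed

text \<open>(C2): runs within one region start at the same place, and the larger value allows the
  longer run. (C3): if the run of \<open>i\<close> covers the last position \<open>p\<close> of a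
  region, then \<open>w p < w i\<close>, so the run of \<open>p\<close> can be appended to
  it.\<close>

lemma code_in_C_tuples:
  assumes w: "w \<in> alpha_perms n \<alpha>"
  shows "code w \<in> C_tuples n \<alpha>"
proof -
  have c1: "0 \<le> code w i" "code w i \<le> int n - int (psum \<alpha> (region \<alpha> i))" if "i \<in> {1..n}" for i
    using reach_bounds[of i w] that by (auto simp: code_def rend_def)
  have c2: "code w i \<le> code w (i + 1)"
    if i: "i \<in> {1..n-1}" and eq: "region \<alpha> i = region \<alpha> (i + 1)" for i
  proof -
    have i': "1 \<le> i" "i + 1 \<le> n"
      using i by auto
    have r: "rend (i + 1) = rend i"
      using eq by (simp add: rend_def)
    have "w i < w (i + 1)"
      using w i eq by (simp add: alpha_perms_def)
    then have "\<forall>j \<in> {rend i<..reach w i}. w j < w (i + 1)"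
      using le_reach_iff[of i "reach w i" w] reach_bounds[of i w] i' by auto
    then have "reach w i \<le> reach w (i + 1)"
      using le_reach_iff[of "i + 1" "reach w i" w] reach_bounds[of i w] i' r by auto
    then show ?thesis
      using i' r by (simp add: code_def)
  qed
  have c3: "code w (psum \<alpha> a) \<le> code w i - int (psum \<alpha> a) + int (psum \<alpha> (region \<alpha> i))"
    if i: "i \<in> {1..psum \<alpha> (length \<alpha> - 2)}" and a: "a \<in> {region \<alpha> i + 1..length \<alpha> - 1}"
      and le: "code w i \<ge> int (psum \<alpha> a) - int (psum \<alpha> (region \<alpha> i))" for i a
  proof -
    let ?p = "psum \<alpha> a"
    have i': "1 \<le> i" "i \<le> n"
      using i psum_mono[of "length \<alpha> - 2" "length \<alpha>"] by auto
    have p: "rend i < ?p" "?p \<le> n"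
      using psum_strict_mono[of "region \<alpha> i" a] psum_mono[of a "length \<alpha>"] a by (auto simp: rend_def)
    \<comment> \<open>As \<open>?p\<close> ends its region, its own run starts at the very next
      position, leaving no gap when the two runs are joined.\<close>
    have rp: "rend ?p = ?p"
      unfolding rend_def by (subst region_psum) (use a in auto)
    have p_le: "?p \<le> reach w i"
      using le i' by (simp add: code_def rend_def)
    have below_i: "\<forall>j \<in> {rend i<..?p}. w j < w i"
      using le_reach_iff[of i ?p w] p p_le i' by auto
    have "\<forall>j \<in> {?p<..reach w ?p}. w j < w ?p"
      using le_reach_iff[of ?p "reach w ?p" w] reach_bounds[of ?p w] p rp by auto
    moreover have "w ?p < w i"
      using below_i p by auto
    ultimately have "\<forall>j \<in> {rend i<..reach w ?p}. w j < w i"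
      using below_i by (metis greaterThanAtMost_iff not_le order.strict_trans)
    then have "reach w ?p \<le> reach w i"
      using le_reach_iff[of i "reach w ?p" w] reach_bounds[of ?p w] p rp i' by auto
    then show ?thesis
      using i' p rp by (simp add: code_def rend_def)
  qed
  show ?thesis
    unfolding C_tuples_def using c1 c2 c3 by (auto simp: code_def)
qed

section \<open>The permutation of a tuple\<close>

lemma trancl_short_bounds:
  assumes "(i, k) \<in> (short c)\<^sup>+"
  shows "1 \<le> i" "i \<le> n" "rend i < k" "k \<le> n"
proof -
  have "1 \<le> i \<and> i \<le> n \<and> rend i < k \<and> k \<le> n"
    using assms
  proof (induction rule: trancl_induct)
    case (step m k)
    then show ?case
      using rend_ge[of m] by (auto simp: short_def)
  qed (auto simp: short_def)
  then show "1 \<le> i" "i \<le> n" "rend i < k" "k \<le> n"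
    by auto
qed

text \<open>A single pair splits at \<open>j\<close>: inside the region of \<open>i\<close>, (C2)
  gives \<open>j\<close> a run at least as long from the same start; beyond it, \<open>j\<close>
  lies in the run of \<open>i\<close>. In a chain, either \<open>j\<close> is one of the vertices or
  the link passing over \<open>j\<close> is split.\<close>

lemma trancl_short_cotrans:
  assumes c: "c \<in> C_tuples n \<alpha>" and ik: "(i, k) \<in> (short c)\<^sup>+" and j: "i < j" "j < k"
  shows "(i, j) \<in> (short c)\<^sup>+ \<or> (j, k) \<in> (short c)\<^sup>+"
proof -
  have short_cotrans: "(i, j) \<in> short c \<or> (j, m) \<in> short c"
    if im: "(i, m) \<in> short c" and j: "i < j" "j < m" for i j m
  proof (cases "j \<le> rend i")
    case True
    then have "rend j = rend i" "c i \<le> c j"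
      using region_eq_iff[of i j] C_tuplesD(4)[OF c, of i j] im j by (auto simp: rend_def short_def)
    then show ?thesis
      using im j by (auto simp: short_def)
  next
    case False
    then show ?thesis
      using im j by (auto simp: short_def)
  qed
  show ?thesis
    using ik j
  proof (induction arbitrary: j rule: converse_trancl_induct)
    case (base i)
    then show ?case
      using short_cotrans[of i k j] by auto
  next
    case (step i m)
    consider "j < m" | "j = m" | "m < j"
      by linarith
    then show ?case
    proof cases
      case 1
      then show ?thesis
        using short_cotrans[of i m j] step by (meson less_imp_le r_into_trancl trancl_into_trancl2)
    next
      case 2
      then show ?thesis
        using step by auto
    next
      case 3
      then show ?thesis
        using step.IH[of j] step by (meson trancl_into_trancl2)
    qed
  qed
qed

text \<open>Here \<open>q\<close> ends the run of \<open>i\<close>; the point is that no chain from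
  \<open>i\<close> hits \<open>Suc q\<close>. A link from some \<open>m \<le> q\<close> either
  starts in a region that extends past \<open>q\<close>, and then jumps beyond the region of
  \<open>Suc q\<close>, or starts in a region ending by \<open>q\<close>, and then stays within the
  run of \<open>i\<close>.\<close>

lemma trancl_short_skips:
  assumes c: "c \<in> C_tuples n \<alpha>" and ik: "(i, k) \<in> (short c)\<^sup>+"
    and q: "int q = int (rend i) + c i" "q < n"
  shows "k \<le> q \<or> rend (Suc q) < k"
  using ik
proof (induction rule: trancl_induct)
  case (base k)
  then show ?case
    using q by (auto simp: short_def)
next
  case (step m k)
  have im: "1 \<le> i" "i \<le> n" "rend i < m" "m \<le> n"
    using trancl_short_bounds[OF step(1)] by auto
  have mk: "rend m < k" "int k \<le> int (rend m) + c m"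
    using step(2) by (auto simp: short_def)
  consider "rend (Suc q) < m" | "m \<le> q" "Suc q \<le> rend m" | "m \<le> q" "rend m \<le> q"
    using step.IH by linarith
  then show ?case
  proof cases
    case 1
    then show ?thesis
      using mk rend_ge[of m] im by simp
  next
    case 2
    then have "rend (Suc q) = rend m"
      using region_eq_iff[of m "Suc q"] q im by (simp add: rend_def)
    then show ?thesis
      using mk by simp
  next
    case 3
    \<comment> \<open>(C3) controls only the last position of the region of \<open>m\<close>; (C2)
      carries the bound over to \<open>m\<close>. It applies because
      \<open>rend m \<le> q < n\<close>.\<close>
    then have "int (rend m) + c (rend m) \<le> int (rend i) + c i"
      using C_tuplesD(5)[OF c, of i m] im q by simp
    moreover have "c m \<le> c (rend m)"
      using C_tuplesD(4)[OF c, of m "rend m"] im rend_ge[of m] rend_le[of m] by simp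
    ultimately show ?thesis
      using mk q by simp
  qed
qed

lemma C_tuples_subset_code_image:
  assumes c: "c \<in> C_tuples n \<alpha>"
  shows "c \<in> code ` alpha_perms_231 n \<alpha>"
proof -
  let ?T = "(short c)\<^sup>+"
  have bounds: "1 \<le> i \<and> i < j \<and> j \<le> n" if "(i, j) \<in> ?T" for i j
    using trancl_short_bounds[OF that] rend_ge[of i] by simp
  obtain w where perm: "w permutes {1..n}" and Inv: "Inv n w = ?T"
    by (rule biclosed_eq_Inv[of ?T n]) (use bounds trancl_short_cotrans[OF c] trans_trancl in blast)+
  have wa: "w \<in> alpha_perms n \<alpha>"
  proof -
    have "w i < w (i + 1)" if i: "i \<in> {1..n-1}" and eq: "region \<alpha> i = region \<alpha> (i + 1)" for i
    proof -
      have "i + 1 \<le> rend i"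
        using region_eq_iff[of i "i + 1"] i eq by force
      \<comment> \<open>Every chain leaves the region of its first position, so no inversion arises
        inside a region.\<close>
      then have "(i, i + 1) \<notin> Inv n w"
        unfolding Inv using trancl_short_bounds(3)[of i "i + 1" c] by auto
      moreover have "w i \<noteq> w (i + 1)"
        by (simp add: inj_eq[OF permutes_inj[OF perm]])
      ultimately show ?thesis
        using i by (auto simp: Inv_iff)
    qed
    then show ?thesis
      using perm by (simp add: alpha_perms_def)
  qed
  have "\<not> has_231_pattern n \<alpha> w"
  proof
    assume "has_231_pattern n \<alpha> w"
    then obtain i j k where ijk: "1 \<le> i" "i < j" "j < k" "k \<le> n" "region \<alpha> i \<noteq> region \<alpha> j"
      "w i < w j" "w i = w k + 1"
      by (auto simp: has_231_pattern_def)
    have "(i, k) \<in> ?T"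
      unfolding Inv[symmetric] using ijk by (simp add: Inv_iff)
    \<comment> \<open>The values at \<open>i\<close> and \<open>k\<close> are consecutive, so no
      intermediate vertex can have its value between them and the pair must be short. The run of
      \<open>i\<close> then covers \<open>j\<close>, against \<open>w i < w j\<close>.\<close>
    then consider "(i, k) \<in> short c" | m where "(i, m) \<in> short c" "(m, k) \<in> ?T"
      by (rule converse_tranclE)
    then have "(i, k) \<in> short c"
    proof cases
      case (2 m)
      then have "(i, m) \<in> Inv n w" "(m, k) \<in> Inv n w"
        unfolding Inv by auto
      then show ?thesis
        using ijk by (auto simp: Inv_iff)
    qed
    moreover have "rend i < j"
      using region_eq_iff[of i j] ijk by simp
    ultimately have "(i, j) \<in> short c"
      using ijk by (simp add: short_def)
    then have "(i, j) \<in> Inv n w"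
      unfolding Inv by auto
    then show False
      using ijk by (simp add: Inv_iff)
  qed
  moreover have "code w = c"
  proof (rule extensionalityI[of _ "{1..n}"])
    fix i assume i: "i \<in> {1..n}"
    define q where "q = nat (int (rend i) + c i)"
    have q: "int q = int (rend i) + c i" "rend i \<le> q" "q \<le> n"
      using C_tuplesD(2,3)[OF c, of i] i by (auto simp: q_def)
    have "w j < w i" if "j \<in> {rend i<..q}" for j
    proof -
      have "(i, j) \<in> short c"
        using i q that by (auto simp: short_def)
      then have "(i, j) \<in> Inv n w"
        unfolding Inv by auto
      then show ?thesis
        by (simp add: Inv_iff)
    qed
    then have "q \<le> reach w i"
      using le_reach_iff[of i q w] i q by auto
    \<comment> \<open>A longer run would make \<open>(i, Suc q)\<close> an inversion and so a pair
      of the closure, although \<open>Suc q\<close> is neither at most \<open>q\<close> nor past the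
      end of its own region.\<close>
    moreover have "\<not> Suc q \<le> reach w i"
    proof
      assume le: "Suc q \<le> reach w i"
      then have qn: "q < n"
        using reach_bounds(2)[of i w] i by simp
      then have "w (Suc q) < w i"
        using le_reach_iff[of i "Suc q" w] i q le by auto
      then have "(i, Suc q) \<in> ?T"
        unfolding Inv[symmetric] using i q qn rend_ge[of i] by (simp add: Inv_iff)
      from trancl_short_skips[OF c this q(1) qn] show False
        using rend_ge[of "Suc q"] qn by simp
    qed
    ultimately show "code w i = c i"
      using q i by (simp add: code_def)
  qed (use C_tuplesD(1)[OF c] in \<open>auto simp: code_def\<close>)
  ultimately show ?thesis
    using wa by (auto simp: alpha_perms_231_def)
qed

section \<open>Agreement of the two orders\<close>

lemma comp_le_code_iff:
  assumes "u \<in> alpha_perms_231 n \<alpha>" "v \<in> alpha_perms_231 n \<alpha>"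
  shows "comp_le n (code u) (code v) \<longleftrightarrow> left_weak_le n u v"
  \<comment> \<open>A componentwise larger tuple has more short pairs, hence a larger closure, which
    is the inversion set; the converse is \<open>code_mono\<close>.\<close>
  unfolding left_weak_le_def
  using Inv_eq_trancl_short[OF assms(1)] Inv_eq_trancl_short[OF assms(2)]
    code_mono[of u v] trancl_mono_subset[OF short_mono, of "code u" "code v"] by auto

lemma antisym_left_weak_le:
  assumes "u \<in> alpha_perms_231 n \<alpha>" "v \<in> alpha_perms_231 n \<alpha>"
    "left_weak_le n u v" "left_weak_le n v u"
  shows "u = v"
  using assms by (intro Inv_inject[of u n v])
    (auto simp: alpha_perms_231_def alpha_perms_def left_weak_le_def)

lemma antisym_comp_le:
  assumes "c \<in> C_tuples n \<alpha>" "d \<in> C_tuples n \<alpha>" "comp_le n c d" "comp_le n d c"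
  shows "c = d"
  using assms C_tuplesD(1)
  by (intro extensionalityI[of c "{1..n}" d]) (auto simp: comp_le_def intro: order.antisym)

lemma poset_iso_code:
  "poset_iso (alpha_perms_231 n \<alpha>) (relation_of (left_weak_le n) (alpha_perms_231 n \<alpha>))
     (C_tuples n \<alpha>) (relation_of (comp_le n) (C_tuples n \<alpha>)) code"
  (is "poset_iso ?A _ ?B _ _")
proof -
  have into: "code u \<in> ?B" if "u \<in> ?A" for u
    using that code_in_C_tuples by (simp add: alpha_perms_231_def)
  \<comment> \<open>Equal tuples are comparable in both directions, so injectivity follows from the
    order embedding and antisymmetry of the weak order.\<close>
  have "inj_on code ?A"
  proof (rule inj_onI)
    fix u v assume uv: "u \<in> ?A" "v \<in> ?A" "code u = code v"
    then have "left_weak_le n u v" "left_weak_le n v u"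
      using comp_le_code_iff[of u v] comp_le_code_iff[of v u] by (simp_all add: comp_le_def)
    then show "u = v"
      using uv antisym_left_weak_le by blast
  qed
  then have "bij_betw code ?A ?B"
    using into C_tuples_subset_code_image by (auto simp: bij_betw_def)
  moreover have "partial_order_on ?A (relation_of (left_weak_le n) ?A)"
    by (rule partial_order_on_relation_ofI)
      (auto simp: left_weak_le_def intro: antisym_left_weak_le[unfolded left_weak_le_def])
  moreover have "partial_order_on ?B (relation_of (comp_le n) ?B)"
  proof (rule partial_order_on_relation_ofI)
    show "comp_le n a c" if "comp_le n a b" "comp_le n b c" for a b c
      using that by (fastforce simp: comp_le_def)
  qed (auto simp: comp_le_def intro: antisym_comp_le[unfolded comp_le_def])
  ultimately show ?thesis
    using into comp_le_code_iff by (auto simp: poset_iso_def relation_of_def)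
qed

end

theorem theorem1p1:
  fixes n :: nat and \<alpha> :: "nat list"
  assumes "n > 0" and "composition_of n \<alpha>"
  shows "\<exists>f. poset_iso
           (alpha_perms_231 n \<alpha>) (relation_of (left_weak_le n) (alpha_perms_231 n \<alpha>))
           (C_tuples n \<alpha>) (relation_of (comp_le n) (C_tuples n \<alpha>)) f"
proof -
  interpret composition n \<alpha>
    using assms(2) by unfold_locales
  show ?thesis
    using poset_iso_code by blast
qed

end
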